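(* Assume $\mathfrak b>\aleph_1$. Then there exists an ultraproduct problem $\mathbf m=\langle (M^{\mathbf m,1}_n, M^{\mathbf m,2}_n,\tau_{\mathbf m,n}) : n<\omega\rangle$ such that (1) $M^{\mathbf m,1}_n\equiv M^{\mathbf m,2}_n$ for every $n<\omega$, and (2) for every non-principal ultrafilter $\mathcal D$ on $\omega$, $\prod_{\mathcal D} M^{\mathbf m,1}_n\not\cong\prod_{\mathcal D} M^{\mathbf m,2}_n$.
   Context: $\mathfrak b$ is the bounding number: the least size of a family $\mathcal F\subseteq{}^\omega\omega$ that is unbounded with respect to eventual domination $\le^*$. A pseudo ultraproduct problem is a sequence $\mathbf m=\langle (M^{\mathbf m,1}_n, M^{\mathbf m,2}_n,\tau_{\mathbf m,n}) : n<\omega\rangle$ where $\langle\tau_{\mathbf m,n}:n<\omega\rangle$ is a $\subseteq$-increasing sequence of finite vocabularies with $\tau_{\mathbf m,0}=\emptyset$, $\tau_{\mathbf m}=\bigcup_n\tau_{\mathbf m,n}$ (possibly finite), each $M^{\mathbf m,\ell}_n$ ($\ell=1,2$) is a $\tau_{\mathbf m}$-structure, and every $M^{\mathbf m,\ell}_n$ has universe of cardinality $\le\aleph_1$. For $k\le n<\omega$, the Ehrenfeucht–Fraïssé game $\Game^n_k(\mathbf m)$ between a protagonist and an antagonist has $2(k+1)$ moves, i.e. rounds $l=0,\dots,k$: in round $l$ the antagonist chooses $A_l\subseteq M^{\mathbf m,1}_n$, $B_l\subseteq M^{\mathbf m,2}_n$ with $|A_l|+|B_l|\le k$; then the protagonist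 chooses a partial one-to-one function $f_l$ from $M^{\mathbf m,1}_n$ into $M^{\mathbf m,2}_n$ with $f_l\supseteq f_{l-1}$ ($f_{-1}=\emptyset$), $A_l\subseteq\mathrm{dom}(f_l)$, $B_l\subseteq\mathrm{range}(f_l)$, such that $f_l$ preserves each strictly atomic $\tau_{\mathbf m,k}$-formula and its negation (strictly atomic formulas: $x=y$, $P(x_0,\dots,x_{m-1})$, $F(x_0,\dots,x_{m-1})=y$, with $P$ a predicate symbol and $F$ a function symbol or constant). The protagonist loses if at some point he has no legal move, and wins otherwise. Let $\mathbf k_{\mathbf m,n}$ be the maximal $k\le n$ such that the protagonist has a winning strategy in $\Game^n_k(\mathbf m)$. $\mathbf m$ is an ultraproduct problem if $\limsup_{n}\mathbf k_{\mathbf m,n}=\infty$. *)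

theory Defs
  imports Main "HOL-Library.Extended_Nat" "HOL-Library.Liminf_Limsup" "HOL-Library.FuncSet"
begin

unbundle cardinal_syntax

abbreviation aleph_one :: "nat set rel"
  where "aleph_one \<equiv> cardSuc natLeq"

definition eventually_le :: "(nat \<Rightarrow> nat) \<Rightarrow> (nat \<Rightarrow> nat) \<Rightarrow> bool"  (infix \<open>\<le>*\<close> 50)
  where "f \<le>* g \<longleftrightarrow> (\<forall>\<^sub>F n in sequentially. f n \<le> g n)"

definition unbounded_family :: "(nat \<Rightarrow> nat) set \<Rightarrow> bool"
  where "unbounded_family F \<longleftrightarrow> (\<nexists>g. \<forall>f\<in>F. f \<le>* g)"

text \<open>Cardinals are represented, as in the library, by well-order relations; the family chosen
  here exists by \<open>bounding_number_least\<close> below.\<close>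

definition bounding_number :: "(nat \<Rightarrow> nat) rel"
  where "bounding_number =
    card_of (SOME F. unbounded_family F \<and> (\<forall>G. unbounded_family G \<longrightarrow> |F| \<le>o |G| ))"

lemma unbounded_family_UNIV: "unbounded_family UNIV"
  unfolding unbounded_family_def eventually_le_def
proof
  assume "\<exists>g::nat \<Rightarrow> nat. \<forall>f\<in>UNIV. \<forall>\<^sub>F n in sequentially. f n \<le> g n"
  then obtain g :: "nat \<Rightarrow> nat" where "\<forall>f. \<forall>\<^sub>F n in sequentially. f n \<le> g n" by blast
  then have "\<forall>\<^sub>F n in sequentially. Suc (g n) \<le> g n" by (rule spec)
  then show False by simp
qed

lemma bounding_number_least:
  "\<exists>F. unbounded_family F \<and> bounding_number = |F| \<and> (\<forall>G. unbounded_family G \<longrightarrow> |F| \<le>o |G| )"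
proof -
  have "\<exists>r\<in>card_of ` Collect unbounded_family. \<forall>r'\<in>card_of ` Collect unbounded_family. r \<le>o r'"
    using unbounded_family_UNIV by (intro exists_minim_Card_order) (auto simp: card_of_Card_order)
  then have "\<exists>F. unbounded_family F \<and> (\<forall>G. unbounded_family G \<longrightarrow> |F| \<le>o |G| )"
    by auto
  from someI_ex[OF this] show ?thesis
    unfolding bounding_number_def by blast
qed

text \<open>A symbol carries its name and its arity; constants are function symbols of arity \<open>0\<close>.
  A vocabulary is a set of symbols. Countably many names suffice, since all the vocabularies
  considered are countable.\<close>

datatype symbol = PredSym nat nat | FunSym nat nat

text \<open>The symbol occurring at the head of \<open>App F ts\<close> is \<open>FunSym F (length ts)\<close>, the one
  in \<open>Rel P ts\<close> is \<open>PredSym P (length ts)\<close>.\<close>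

datatype trm = Var nat | App nat "trm list"

datatype fm = Eq trm trm | Rel nat "trm list" | Neg fm | Conj fm fm | Exi nat fm

primrec fv_trm :: "trm \<Rightarrow> nat set" where
  "fv_trm (Var x) = {x}"
| "fv_trm (App F ts) = \<Union> (set (map fv_trm ts))"

primrec fv :: "fm \<Rightarrow> nat set" where
  "fv (Eq t u) = fv_trm t \<union> fv_trm u"
| "fv (Rel P ts) = \<Union> (fv_trm ` set ts)"
| "fv (Neg \<phi>) = fv \<phi>"
| "fv (Conj \<phi> \<psi>) = fv \<phi> \<union> fv \<psi>"
| "fv (Exi x \<phi>) = fv \<phi> - {x}"

primrec symbols_trm :: "trm \<Rightarrow> symbol set" where
  "symbols_trm (Var x) = {}"
| "symbols_trm (App F ts) = insert (FunSym F (length ts)) (\<Union> (set (map symbols_trm ts)))"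

primrec symbols_fm :: "fm \<Rightarrow> symbol set" where
  "symbols_fm (Eq t u) = symbols_trm t \<union> symbols_trm u"
| "symbols_fm (Rel P ts) = insert (PredSym P (length ts)) (\<Union> (symbols_trm ` set ts))"
| "symbols_fm (Neg \<phi>) = symbols_fm \<phi>"
| "symbols_fm (Conj \<phi> \<psi>) = symbols_fm \<phi> \<union> symbols_fm \<psi>"
| "symbols_fm (Exi x \<phi>) = symbols_fm \<phi>"

definition sentence :: "symbol set \<Rightarrow> fm \<Rightarrow> bool"
  where "sentence \<tau> \<phi> \<longleftrightarrow> symbols_fm \<phi> \<subseteq> \<tau> \<and> fv \<phi> = {}"

text \<open>The interpretation of a symbol of arity \<open>k\<close> is given by the values on lists of length
  \<open>k\<close> over the universe. All other values, and those at symbols outside the vocabulary under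
  consideration, are irrelevant to every notion below.\<close>

record 'a struct =
  universe :: "'a set"
  pred :: "nat \<Rightarrow> 'a list \<Rightarrow> bool"
  func :: "nat \<Rightarrow> 'a list \<Rightarrow> 'a"

definition tuples :: "'a set \<Rightarrow> nat \<Rightarrow> 'a list set"
  where "tuples A k = {xs. set xs \<subseteq> A \<and> length xs = k}"

definition is_structure :: "symbol set \<Rightarrow> 'a struct \<Rightarrow> bool"
  where "is_structure \<tau> M \<longleftrightarrow> universe M \<noteq> {} \<and>
    (\<forall>F k. FunSym F k \<in> \<tau> \<longrightarrow> (\<forall>xs\<in>tuples (universe M) k. func M F xs \<in> universe M))"

primrec eval :: "'a struct \<Rightarrow> (nat \<Rightarrow> 'a) \<Rightarrow> trm \<Rightarrow> 'a" where
  "eval M s (Var x) = s x"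
| "eval M s (App F ts) = func M F (map (eval M s) ts)"

primrec sat :: "'a struct \<Rightarrow> (nat \<Rightarrow> 'a) \<Rightarrow> fm \<Rightarrow> bool" where
  "sat M s (Eq t u) \<longleftrightarrow> eval M s t = eval M s u"
| "sat M s (Rel P ts) \<longleftrightarrow> pred M P (map (eval M s) ts)"
| "sat M s (Neg \<phi>) \<longleftrightarrow> \<not> sat M s \<phi>"
| "sat M s (Conj \<phi> \<psi>) \<longleftrightarrow> sat M s \<phi> \<and> sat M s \<psi>"
| "sat M s (Exi x \<phi>) \<longleftrightarrow> (\<exists>a\<in>universe M. sat M (s(x := a)) \<phi>)"

definition models :: "'a struct \<Rightarrow> fm \<Rightarrow> bool"
  where "models M \<phi> \<longleftrightarrow> (\<forall>s. range s \<subseteq> universe M \<longrightarrow> sat M s \<phi>)"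

definition elementarily_equivalent :: "symbol set \<Rightarrow> 'a struct \<Rightarrow> 'b struct \<Rightarrow> bool"
  where "elementarily_equivalent \<tau> M N \<longleftrightarrow> (\<forall>\<phi>. sentence \<tau> \<phi> \<longrightarrow> (models M \<phi> \<longleftrightarrow> models N \<phi>))"

definition isomorphism :: "symbol set \<Rightarrow> 'a struct \<Rightarrow> 'b struct \<Rightarrow> ('a \<Rightarrow> 'b) \<Rightarrow> bool"
  where "isomorphism \<tau> M N h \<longleftrightarrow> bij_betw h (universe M) (universe N) \<and>
    (\<forall>P k. PredSym P k \<in> \<tau> \<longrightarrow>
      (\<forall>xs\<in>tuples (universe M) k. pred M P xs \<longleftrightarrow> pred N P (map h xs))) \<and>
    (\<forall>F k. FunSym F k \<in> \<tau> \<longrightarrow>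
      (\<forall>xs\<in>tuples (universe M) k. h (func M F xs) = func N F (map h xs)))"

definition isomorphic :: "symbol set \<Rightarrow> 'a struct \<Rightarrow> 'b struct \<Rightarrow> bool"
  where "isomorphic \<tau> M N \<longleftrightarrow> (\<exists>h. isomorphism \<tau> M N h)"

definition ultrafilter :: "'i filter \<Rightarrow> bool"
  where "ultrafilter D \<longleftrightarrow>
    D \<noteq> bot \<and> (\<forall>P. (\<forall>\<^sub>F i in D. P i) \<or> (\<forall>\<^sub>F i in D. \<not> P i))"

definition nonprincipal :: "'i filter \<Rightarrow> bool"
  where "nonprincipal D \<longleftrightarrow> (\<forall>A. D \<noteq> principal A)"

definition ultra_rel :: "'i filter \<Rightarrow> ('i \<Rightarrow> 'a struct) \<Rightarrow> ('i \<Rightarrow> 'a) rel"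
  where "ultra_rel D M =
    {(f, g). f \<in> (\<Pi> i\<in>UNIV. universe (M i)) \<and> g \<in> (\<Pi> i\<in>UNIV. universe (M i)) \<and>
      (\<forall>\<^sub>F i in D. f i = g i)}"

abbreviation representative :: "'b set \<Rightarrow> 'b"
  where "representative X \<equiv> (SOME f. f \<in> X)"

text \<open>The interpretations do not depend on the choice of representatives, see
  \<open>pred_ultraproduct\<close> and \<open>func_ultraproduct\<close> below.\<close>

definition ultraproduct :: "'i filter \<Rightarrow> ('i \<Rightarrow> 'a struct) \<Rightarrow> ('i \<Rightarrow> 'a) set struct"
  where "ultraproduct D M = \<lparr>
    universe = (\<Pi> i\<in>UNIV. universe (M i)) // ultra_rel D M,
    pred = (\<lambda>P Xs. \<forall>\<^sub>F i in D. pred (M i) P (map (\<lambda>X. representative X i) Xs)),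
    func = (\<lambda>F Xs. ultra_rel D M `` {\<lambda>i. func (M i) F (map (\<lambda>X. representative X i) Xs)}) \<rparr>"

lemma eventually_representatives:
  assumes "set fs \<subseteq> (\<Pi> i\<in>UNIV. universe (M i))"
  shows "\<forall>\<^sub>F i in D.
    map (\<lambda>X. representative X i) (map (\<lambda>f. ultra_rel D M `` {f}) fs) = map (\<lambda>f. f i) fs"
  using assms
proof (induction fs)
  case Nil
  show ?case by simp
next
  case (Cons f fs)
  have "f \<in> ultra_rel D M `` {f}"
    using Cons.prems by (auto simp: ultra_rel_def)
  then have "representative (ultra_rel D M `` {f}) \<in> ultra_rel D M `` {f}"
    by (rule someI[where P = "\<lambda>g. g \<in> ultra_rel D M `` {f}"])
  then have "\<forall>\<^sub>F i in D. representative (ultra_rel D M `` {f}) i = f i"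
    by (auto simp: ultra_rel_def eq_commute)
  with Cons show ?case
    by (auto elim: eventually_elim2)
qed

lemma pred_ultraproduct:
  assumes "set fs \<subseteq> (\<Pi> i\<in>UNIV. universe (M i))"
  shows "pred (ultraproduct D M) P (map (\<lambda>f. ultra_rel D M `` {f}) fs) \<longleftrightarrow>
    (\<forall>\<^sub>F i in D. pred (M i) P (map (\<lambda>f. f i) fs))"
  unfolding ultraproduct_def struct.simps
  by (rule eventually_cong[OF eventually_representatives[OF assms]]) (simp only:)

lemma func_ultraproduct:
  assumes "\<And>i. is_structure \<tau> (M i)" and "FunSym F (length fs) \<in> \<tau>"
    and "set fs \<subseteq> (\<Pi> i\<in>UNIV. universe (M i))"
  shows "func (ultraproduct D M) F (map (\<lambda>f. ultra_rel D M `` {f}) fs) =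
    ultra_rel D M `` {\<lambda>i. func (M i) F (map (\<lambda>f. f i) fs)}"
proof -
  let ?Xs = "map (\<lambda>f. ultra_rel D M `` {f}) fs"
  let ?g = "\<lambda>i. func (M i) F (map (\<lambda>X. representative X i) ?Xs)"
  let ?h = "\<lambda>i. func (M i) F (map (\<lambda>f. f i) fs)"
  have closed: "func (M i) F xs \<in> universe (M i)" if "xs \<in> tuples (universe (M i)) (length fs)" for i xs
    using assms(1)[of i] assms(2) that by (auto simp: is_structure_def)
  have rep: "representative (ultra_rel D M `` {f}) i \<in> universe (M i)" if "f \<in> set fs" for f i
  proof -
    have "f \<in> ultra_rel D M `` {f}"
      using assms(3) that by (auto simp: ultra_rel_def)
    then have "representative (ultra_rel D M `` {f}) \<in> ultra_rel D M `` {f}"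
      by (rule someI[where P = "\<lambda>g. g \<in> ultra_rel D M `` {f}"])
    then show ?thesis by (auto simp: ultra_rel_def)
  qed
  have "?g i \<in> universe (M i)" for i
    using rep by (intro closed) (auto simp: tuples_def)
  moreover have "?h i \<in> universe (M i)" for i
    using assms(3) by (intro closed) (auto simp: tuples_def)
  moreover have ev: "\<forall>\<^sub>F i in D. ?g i = ?h i"
    using eventually_representatives[OF assms(3), of D] by (rule eventually_mono) (simp only:)
  moreover have "(\<forall>\<^sub>F i in D. ?g i = k i) \<longleftrightarrow> (\<forall>\<^sub>F i in D. ?h i = k i)" for k
    by (rule eventually_cong[OF ev]) (simp only:)
  ultimately have "ultra_rel D M `` {?g} = ultra_rel D M `` {?h}"
    unfolding ultra_rel_def by (auto simp del: map_map)
  then show ?thesis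
    by (simp only: ultraproduct_def struct.simps)
qed

text \<open>The sequence of triples is given as a triple of sequences. The universes are subsets of a
  common type; every structure of cardinality at most \<open>aleph_one\<close> has an isomorphic copy on
  a subset of \<open>nat set\<close>.\<close>

record 'a upp =
  left :: "nat \<Rightarrow> 'a struct"
  right :: "nat \<Rightarrow> 'a struct"
  vocab :: "nat \<Rightarrow> symbol set"

definition full_vocab :: "'a upp \<Rightarrow> symbol set"
  where "full_vocab m = (\<Union>n. vocab m n)"

definition pseudo_ultraproduct_problem :: "'a upp \<Rightarrow> bool"
  where "pseudo_ultraproduct_problem m \<longleftrightarrow>
    vocab m 0 = {} \<and> (\<forall>n. finite (vocab m n) \<and> vocab m n \<subseteq> vocab m (Suc n)) \<and>
    (\<forall>n. is_structure (full_vocab m) (left m n) \<and> |universe (left m n)| \<le>o aleph_one \<and>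
         is_structure (full_vocab m) (right m n) \<and> |universe (right m n)| \<le>o aleph_one)"

definition strictly_atomic :: "symbol set \<Rightarrow> fm set"
  where "strictly_atomic \<tau> =
    {Eq (Var x) (Var y) | x y. True} \<union>
    {Rel P (map Var xs) | P xs. PredSym P (length xs) \<in> \<tau>} \<union>
    {Eq (App F (map Var xs)) (Var y) | F xs y. FunSym F (length xs) \<in> \<tau>}"

definition preserves :: "'a struct \<Rightarrow> 'b struct \<Rightarrow> ('a \<rightharpoonup> 'b) \<Rightarrow> fm \<Rightarrow> bool"
  where "preserves M N f \<phi> \<longleftrightarrow>
    (\<forall>s. s ` fv \<phi> \<subseteq> dom f \<longrightarrow> sat M s \<phi> \<longrightarrow> sat N (\<lambda>x. the (f (s x))) \<phi>)"

definition legal_challenge :: "'a upp \<Rightarrow> nat \<Rightarrow> nat \<Rightarrow> 'a set \<times> 'a set \<Rightarrow> bool"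
  where "legal_challenge m n k = (\<lambda>(A, B).
    A \<subseteq> universe (left m n) \<and> B \<subseteq> universe (right m n) \<and>
    finite A \<and> finite B \<and> card A + card B \<le> k)"

definition legal_reply ::
    "'a upp \<Rightarrow> nat \<Rightarrow> nat \<Rightarrow> ('a \<rightharpoonup> 'a) \<Rightarrow> 'a set \<times> 'a set \<Rightarrow> ('a \<rightharpoonup> 'a) \<Rightarrow> bool"
  where "legal_reply m n k f_prev = (\<lambda>(A, B) f.
    dom f \<subseteq> universe (left m n) \<and> ran f \<subseteq> universe (right m n) \<and> inj_on f (dom f) \<and>
    f_prev \<subseteq>\<^sub>m f \<and> A \<subseteq> dom f \<and> B \<subseteq> ran f \<and>
    (\<forall>\<phi>\<in>strictly_atomic (vocab m k).
       preserves (left m n) (right m n) f \<phi> \<and> preserves (left m n) (right m n) f (Neg \<phi>)))"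

text \<open>A strategy maps the list of the antagonist's moves made so far, including the one to be
  answered, to the next move of the protagonist. It is winning if its answer is legal in each of the
  rounds \<open>0, \<dots>, k\<close>, whatever legal moves the antagonist makes.\<close>

definition winning_strategy ::
    "'a upp \<Rightarrow> nat \<Rightarrow> nat \<Rightarrow> (('a set \<times> 'a set) list \<Rightarrow> ('a \<rightharpoonup> 'a)) \<Rightarrow> bool"
  where "winning_strategy m n k \<sigma> \<longleftrightarrow>
    (\<forall>cs. length cs = Suc k \<longrightarrow> (\<forall>c\<in>set cs. legal_challenge m n k c) \<longrightarrow>
      (\<forall>l\<le>k. legal_reply m n k
        (if l = 0 then Map.empty else \<sigma> (take l cs)) (cs ! l) (\<sigma> (take (Suc l) cs))))"

definition protagonist_wins :: "'a upp \<Rightarrow> nat \<Rightarrow> nat \<Rightarrow> bool"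
  where "protagonist_wins m n k \<longleftrightarrow> (\<exists>\<sigma>. winning_strategy m n k \<sigma>)"

definition game_value :: "'a upp \<Rightarrow> nat \<Rightarrow> nat"
  where "game_value m n = Max {k. k \<le> n \<and> protagonist_wins m n k}"

lemma protagonist_wins_0:
  assumes "pseudo_ultraproduct_problem m"
  shows "protagonist_wins m n 0"
proof -
  have "winning_strategy m n 0 (\<lambda>_. Map.empty)"
    using assms
    by (auto simp: winning_strategy_def legal_challenge_def legal_reply_def strictly_atomic_def
        preserves_def pseudo_ultraproduct_problem_def length_Suc_conv)
  then show ?thesis unfolding protagonist_wins_def by blast
qed

definition ultraproduct_problem :: "'a upp \<Rightarrow> bool"
  where "ultraproduct_problem m \<longleftrightarrow>
    pseudo_ultraproduct_problem m \<and> limsup (\<lambda>n. enat (game_value m n)) = \<infinity>"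

end

theory Submission
  imports Defs "HOL-Library.Countable"
begin

text \<open>Take for all \<open>M\<^sub>n\<^sup>1\<close> the order \<open>\<omega>\<^sub>1 \<times> \<rat>\<close> (lexicographically) and for all \<open>M\<^sub>n\<^sup>2\<close> the order
  \<open>\<rat>\<close>. Both are dense linear orders without endpoints, so the finite partial isomorphisms form a
  back-and-forth system; this yields elementary equivalence and lets the protagonist win all games.
  A countable subset of \<open>\<omega>\<^sub>1 \<times> \<rat>\<close> is bounded, so the \<open>\<aleph>\<^sub>1\<close> many classes of constant functions are
  cofinal in the first ultraproduct. Fewer than \<open>\<bb>\<close> many elements of the second ultraproduct have a
  common strict upper bound, as \<open>\<nat>\<close> is cofinal in \<open>\<rat>\<close>.\<close>

section \<open>Back-and-forth systems\<close>

text \<open>A relation instead of a partial function keeps the two sides symmetric: the clause on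
  equality expresses functionality and injectivity at once. The vocabularies considered are
  \<open>relational\<close>, so only predicate symbols have a clause.\<close>

definition partial_isomorphism ::
    "symbol set \<Rightarrow> 'a struct \<Rightarrow> 'b struct \<Rightarrow> ('a \<times> 'b) set \<Rightarrow> bool"
  where "partial_isomorphism \<tau> M N R \<longleftrightarrow> R \<subseteq> universe M \<times> universe N \<and>
    (\<forall>x y x' y'. (x, y) \<in> R \<longrightarrow> (x', y') \<in> R \<longrightarrow> (x = x' \<longleftrightarrow> y = y')) \<and>
    (\<forall>P xs ys. PredSym P (length xs) \<in> \<tau> \<longrightarrow> list_all2 (\<lambda>x y. (x, y) \<in> R) xs ys \<longrightarrow>
      (pred M P xs \<longleftrightarrow> pred N P ys))"

definition back_and_forth ::
    "symbol set \<Rightarrow> 'a struct \<Rightarrow> 'b struct \<Rightarrow> ('a \<times> 'b) set set \<Rightarrow> bool"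
  where "back_and_forth \<tau> M N I \<longleftrightarrow> I \<noteq> {} \<and> (\<forall>R\<in>I. partial_isomorphism \<tau> M N R \<and>
    (\<forall>a\<in>universe M. \<exists>b. insert (a, b) R \<in> I) \<and> (\<forall>b\<in>universe N. \<exists>a. insert (a, b) R \<in> I))"

definition relational :: "symbol set \<Rightarrow> bool"
  where "relational \<tau> \<longleftrightarrow> (\<forall>F k. FunSym F k \<notin> \<tau>)"

lemma relational_trm:
  assumes "relational \<tau>" and "symbols_trm t \<subseteq> \<tau>"
  obtains x where "t = Var x"
  using assms by (cases t) (auto simp: relational_def)

text \<open>Relationality reduces every term to a variable, so atomic formulas are read off from
  \<open>R\<close>. The relation and both assignments vary in the induction because a quantifier
  enlarges \<open>R\<close> by one pair.\<close>

lemma back_and_forth_sat: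
  assumes I: "back_and_forth \<tau> M N I" and rel: "relational \<tau>"
    and "symbols_fm \<phi> \<subseteq> \<tau>" and "R \<in> I" and "\<forall>x\<in>fv \<phi>. (s x, s' x) \<in> R"
  shows "sat M s \<phi> \<longleftrightarrow> sat N s' \<phi>"
  using assms(3-)
proof (induction \<phi> arbitrary: R s s')
  case (Eq t u)
  obtain x y where "t = Var x" "u = Var y"
    using Eq.prems(1) relational_trm[OF rel] by (metis Un_subset_iff symbols_fm.simps(1))
  moreover have "partial_isomorphism \<tau> M N R"
    using I Eq.prems(2) by (auto simp: back_and_forth_def)
  ultimately show ?case
    using Eq.prems(3) by (simp add: partial_isomorphism_def)
next
  case (Rel P ts)
  have "list_all2 (\<lambda>x y. (x, y) \<in> R) (map (eval M s) ts) (map (eval N s') ts)"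
    unfolding list_all2_map1 list_all2_map2
  proof (rule list.rel_refl_strong)
    fix t assume t: "t \<in> set ts"
    then obtain x where "t = Var x"
      using Rel.prems(1) relational_trm[OF rel, of t] by auto
    then show "(eval M s t, eval N s' t) \<in> R"
      using Rel.prems(3) t by force
  qed
  moreover have "partial_isomorphism \<tau> M N R"
    using I Rel.prems(2) by (auto simp: back_and_forth_def)
  ultimately show ?case
    using Rel.prems(1) by (simp add: partial_isomorphism_def)
next
  case (Neg \<phi>)
  have "sat M s \<phi> \<longleftrightarrow> sat N s' \<phi>"
    using Neg.prems by (intro Neg.IH[of R]) auto
  then show ?case by simp
next
  case (Conj \<phi> \<psi>)
  have "sat M s \<phi> \<longleftrightarrow> sat N s' \<phi>"
    using Conj.prems by (intro Conj.IH(1)[of R]) auto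
  moreover have "sat M s \<psi> \<longleftrightarrow> sat N s' \<psi>"
    using Conj.prems by (intro Conj.IH(2)[of R]) auto
  ultimately show ?case by simp
next
  case (Exi x \<phi>)
  \<comment> \<open>After the update, \<open>(a, b)\<close> relates the values at \<open>x\<close>,
    and \<open>R\<close> still relates the values at the other free variables.\<close>
  have step: "sat M (s(x := a)) \<phi> \<longleftrightarrow> sat N (s'(x := b)) \<phi>" if "insert (a, b) R \<in> I" for a b
    using Exi.prems that by (intro Exi.IH[of "insert (a, b) R"]) auto
  have univ: "a \<in> universe M \<and> b \<in> universe N" if "insert (a, b) R \<in> I" for a b
    using I that by (auto simp: back_and_forth_def partial_isomorphism_def)
  have "\<exists>b. insert (a, b) R \<in> I" if "a \<in> universe M" for a
    using I Exi.prems(2) that by (auto simp: back_and_forth_def)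
  moreover have "\<exists>a. insert (a, b) R \<in> I" if "b \<in> universe N" for b
    using I Exi.prems(2) that by (auto simp: back_and_forth_def)
  ultimately show ?case
    using step univ by (simp, metis)
qed

lemma back_and_forth_elementarily_equivalent:
  assumes I: "back_and_forth \<tau> M N I" and rel: "relational \<tau>"
    and "universe M \<noteq> {}" and "universe N \<noteq> {}"
  shows "elementarily_equivalent \<tau> M N"
  unfolding elementarily_equivalent_def
proof (intro allI impI)
  fix \<phi> assume "sentence \<tau> \<phi>"
  moreover obtain R where "R \<in> I" using I by (auto simp: back_and_forth_def)
  ultimately have eq: "sat M s \<phi> \<longleftrightarrow> sat N s' \<phi>" for s s'
    using back_and_forth_sat[OF I rel] by (auto simp: sentence_def)
  \<comment> \<open>\<open>models\<close> quantifies over assignments into the universe; constant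
    ones show that such assignments exist on both sides, so that neither side holds
    vacuously.\<close>
  obtain a b where "a \<in> universe M" "b \<in> universe N" using assms by blast
  then have "range (\<lambda>_::nat. a) \<subseteq> universe M" "range (\<lambda>_::nat. b) \<subseteq> universe N" by auto
  then show "models M \<phi> \<longleftrightarrow> models N \<phi>"
    unfolding models_def using eq by blast
qed

section \<open>Winning strategies from back-and-forth systems\<close>

lemma back_and_forth_extend:
  assumes I: "back_and_forth \<tau> M N I" and "R \<in> I"
    and "finite A" "A \<subseteq> universe M" "finite B" "B \<subseteq> universe N"
  shows "\<exists>R'\<in>I. R \<subseteq> R' \<and> A \<subseteq> Domain R' \<and> B \<subseteq> Range R'"
proof -
  have "\<exists>R'\<in>I. R \<subseteq> R' \<and> A \<subseteq> Domain R'"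
    using \<open>finite A\<close> \<open>A \<subseteq> universe M\<close>
  proof (induction A rule: finite_induct)
    case empty
    then show ?case using \<open>R \<in> I\<close> by auto
  next
    case (insert a A)
    then obtain R' where R': "R' \<in> I" "R \<subseteq> R'" "A \<subseteq> Domain R'" by auto
    moreover obtain b where "insert (a, b) R' \<in> I"
      using I R'(1) insert.prems unfolding back_and_forth_def by blast
    ultimately show ?case by (intro bexI[of _ "insert (a, b) R'"]) auto
  qed
  then obtain R1 where R1: "R1 \<in> I" "R \<subseteq> R1" "A \<subseteq> Domain R1" by blast
  have "\<exists>R'\<in>I. R1 \<subseteq> R' \<and> B \<subseteq> Range R'"
    using \<open>finite B\<close> \<open>B \<subseteq> universe N\<close>
  proof (induction B rule: finite_induct)
    case empty
    then show ?case using \<open>R1 \<in> I\<close> by auto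
  next
    case (insert b B)
    then obtain R' where R': "R' \<in> I" "R1 \<subseteq> R'" "B \<subseteq> Range R'" by auto
    moreover obtain a where "insert (a, b) R' \<in> I"
      using I R'(1) insert.prems unfolding back_and_forth_def by blast
    ultimately show ?case by (intro bexI[of _ "insert (a, b) R'"]) auto
  qed
  then obtain R2 where "R2 \<in> I" "R1 \<subseteq> R2" "B \<subseteq> Range R2" by blast
  with R1 show ?thesis by (meson Domain_mono subset_trans)
qed

text \<open>The game asks for partial functions. The value picked by \<open>SOME\<close> is the only
  candidate as soon as \<open>R\<close> is a partial isomorphism.\<close>

definition map_of_rel :: "('a \<times> 'b) set \<Rightarrow> 'a \<rightharpoonup> 'b"
  where "map_of_rel R = (\<lambda>x. if x \<in> Domain R then Some (SOME y. (x, y) \<in> R) else None)"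

lemma map_of_rel_eq_Some_iff:
  assumes "partial_isomorphism \<tau> M N R"
  shows "map_of_rel R x = Some y \<longleftrightarrow> (x, y) \<in> R"
proof -
  have uniq: "y = y'" if "(x, y) \<in> R" "(x, y') \<in> R" for y y'
    using assms that unfolding partial_isomorphism_def by blast
  have "(x, SOME y. (x, y) \<in> R) \<in> R" if "x \<in> Domain R"
    using that by (auto intro: someI)
  then show ?thesis
    unfolding map_of_rel_def using uniq by auto
qed

text \<open>By \<open>back_and_forth_sat\<close> all formulas over \<open>full_vocab m\<close> are
  preserved along \<open>R\<close>, so negated atoms are covered by the same argument as
  atoms.\<close>

lemma legal_reply_map_of_rel:
  assumes I: "back_and_forth (full_vocab m) (left m n) (right m n) I" "relational (full_vocab m)"
    and R: "R \<in> I" and f: "f_prev \<subseteq>\<^sub>m map_of_rel R" and A: "A \<subseteq> Domain R" and B: "B \<subseteq> Range R"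
  shows "legal_reply m n k f_prev (A, B) (map_of_rel R)"
proof -
  have iso: "partial_isomorphism (full_vocab m) (left m n) (right m n) R"
    using I R by (auto simp: back_and_forth_def)
  note Some_iff = map_of_rel_eq_Some_iff[OF iso]
  have dom: "dom (map_of_rel R) = Domain R" and ran: "ran (map_of_rel R) = Range R"
    by (auto simp: dom_def ran_def Some_iff)
  have inj: "inj_on (map_of_rel R) (dom (map_of_rel R))"
  proof (rule inj_onI)
    fix x x' assume "x \<in> dom (map_of_rel R)" "map_of_rel R x = map_of_rel R x'"
    then obtain y where "(x, y) \<in> R" "(x', y) \<in> R" using Some_iff by (metis domD)
    then show "x = x'" using iso unfolding partial_isomorphism_def by blast
  qed
  have "preserves (left m n) (right m n) (map_of_rel R) \<phi>" if \<phi>: "symbols_fm \<phi> \<subseteq> full_vocab m" for \<phi>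
    unfolding preserves_def
  proof (intro allI impI)
    fix s assume s: "s ` fv \<phi> \<subseteq> dom (map_of_rel R)" and sat: "sat (left m n) s \<phi>"
    have "\<forall>x\<in>fv \<phi>. (s x, the (map_of_rel R (s x))) \<in> R"
      using s Some_iff by (metis domD image_subset_iff option.sel)
    from back_and_forth_sat[OF I \<phi> R this] sat
    show "sat (right m n) (\<lambda>x. the (map_of_rel R (s x))) \<phi>" by simp
  qed
  \<comment> \<open>Atoms with a function symbol do not arise, the vocabulary being relational; the
    others take their symbols from \<open>vocab m k\<close>, a part of
    \<open>full_vocab m\<close>.\<close>
  moreover have "symbols_fm \<phi> \<subseteq> full_vocab m" if "\<phi> \<in> strictly_atomic (vocab m k)" for \<phi>
    using that I(2) by (auto simp: strictly_atomic_def full_vocab_def relational_def)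
  moreover have "R \<subseteq> universe (left m n) \<times> universe (right m n)"
    using iso by (simp add: partial_isomorphism_def)
  ultimately show ?thesis
    using f A B inj by (auto simp: legal_reply_def dom ran)
qed

text \<open>The strategy stays inside \<open>I\<close>: its position after a list of challenges is
  recomputed by folding a one-round extension \<open>step\<close> over that list, starting from some
  \<open>R0\<close>.\<close>

lemma back_and_forth_protagonist_wins:
  assumes I: "back_and_forth (full_vocab m) (left m n) (right m n) I" "relational (full_vocab m)"
  shows "protagonist_wins m n k"
proof -
  obtain R0 where R0: "R0 \<in> I" using I by (auto simp: back_and_forth_def)
  \<comment> \<open>The premises stand under the existential quantifier so that choice yields a
    total function \<open>step\<close>.\<close>
  have "\<forall>R c. \<exists>R'. R \<in> I \<longrightarrow> legal_challenge m n k c \<longrightarrow>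
      R' \<in> I \<and> R \<subseteq> R' \<and> fst c \<subseteq> Domain R' \<and> snd c \<subseteq> Range R'"
  proof (intro allI)
    fix R c
    show "\<exists>R'. R \<in> I \<longrightarrow> legal_challenge m n k c \<longrightarrow>
      R' \<in> I \<and> R \<subseteq> R' \<and> fst c \<subseteq> Domain R' \<and> snd c \<subseteq> Range R'"
      using back_and_forth_extend[OF I(1), of R "fst c" "snd c"]
      by (auto simp: legal_challenge_def split_beta)
  qed
  then obtain step where step: "\<And>R c. R \<in> I \<Longrightarrow> legal_challenge m n k c \<Longrightarrow>
      step R c \<in> I \<and> R \<subseteq> step R c \<and> fst c \<subseteq> Domain (step R c) \<and> snd c \<subseteq> Range (step R c)"
    by metis
  have in_I: "foldl step R0 cs \<in> I" if "\<forall>c\<in>set cs. legal_challenge m n k c" for cs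
    using that by (induction cs rule: rev_induct) (auto simp: R0 step)
  have "winning_strategy m n k (\<lambda>cs. map_of_rel (foldl step R0 cs))"
    unfolding winning_strategy_def
  proof (intro allI impI)
    fix cs l
    assume len: "length cs = Suc k" and legal: "\<forall>c\<in>set cs. legal_challenge m n k c" and "l \<le> k"
    let ?R = "foldl step R0 (take l cs)"
    have R: "?R \<in> I" using legal by (intro in_I) (auto dest: in_set_takeD)
    have "legal_challenge m n k (cs ! l)" using legal len \<open>l \<le> k\<close> by auto
    note S = step[OF R this]
    have take: "foldl step R0 (take (Suc l) cs) = step ?R (cs ! l)"
      using len \<open>l \<le> k\<close> by (simp add: take_Suc_conv_app_nth)
    have iso: "partial_isomorphism (full_vocab m) (left m n) (right m n) R" if "R \<in> I" for R
      using I that by (auto simp: back_and_forth_def)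
    have "map_of_rel ?R \<subseteq>\<^sub>m map_of_rel (step ?R (cs ! l))"
      unfolding map_le_def
    proof
      fix x assume "x \<in> dom (map_of_rel ?R)"
      then obtain y where y: "map_of_rel ?R x = Some y" by blast
      then have "map_of_rel (step ?R (cs ! l)) x = Some y"
        using S R by (auto simp: map_of_rel_eq_Some_iff[OF iso])
      with y show "map_of_rel ?R x = map_of_rel (step ?R (cs ! l)) x" by simp
    qed
    \<comment> \<open>In round \<open>0\<close> the previous function is empty although the fold is
      already at \<open>R0\<close>; the empty map lies below every reply.\<close>
    then show "legal_reply m n k (if l = 0 then Map.empty else map_of_rel ?R) (cs ! l)
        (map_of_rel (foldl step R0 (take (Suc l) cs)))"
      unfolding take using legal_reply_map_of_rel[OF I, of "step ?R (cs ! l)" _ "fst (cs ! l)" "snd (cs ! l)"] S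
      by auto
  qed
  then show ?thesis unfolding protagonist_wins_def by blast
qed

section \<open>Dense linear orders without endpoints\<close>

definition dense_order :: "'a set \<Rightarrow> ('a \<Rightarrow> 'a \<Rightarrow> bool) \<Rightarrow> bool"
  where "dense_order U lt \<longleftrightarrow> U \<noteq> {} \<and>
    (\<forall>x\<in>U. \<not> lt x x) \<and>
    (\<forall>x\<in>U. \<forall>y\<in>U. \<forall>z\<in>U. lt x y \<longrightarrow> lt y z \<longrightarrow> lt x z) \<and>
    (\<forall>x\<in>U. \<forall>y\<in>U. lt x y \<or> x = y \<or> lt y x) \<and>
    (\<forall>x\<in>U. \<forall>y\<in>U. lt x y \<longrightarrow> (\<exists>z\<in>U. lt x z \<and> lt z y)) \<and>
    (\<forall>x\<in>U. \<exists>y\<in>U. lt x y) \<and> (\<forall>x\<in>U. \<exists>y\<in>U. lt y x)"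

lemma
  assumes "dense_order U lt"
  shows dense_order_nonempty: "U \<noteq> {}"
    and dense_order_irrefl: "x \<in> U \<Longrightarrow> \<not> lt x x"
    and dense_order_trans:
      "lt x y \<Longrightarrow> lt y z \<Longrightarrow> x \<in> U \<Longrightarrow> y \<in> U \<Longrightarrow> z \<in> U \<Longrightarrow> lt x z"
    and dense_order_total: "x \<in> U \<Longrightarrow> y \<in> U \<Longrightarrow> lt x y \<or> x = y \<or> lt y x"
    and dense_order_dense: "x \<in> U \<Longrightarrow> y \<in> U \<Longrightarrow> lt x y \<Longrightarrow> \<exists>z\<in>U. lt x z \<and> lt z y"
    and dense_order_no_max: "x \<in> U \<Longrightarrow> \<exists>y\<in>U. lt x y"
    and dense_order_no_min: "x \<in> U \<Longrightarrow> \<exists>y\<in>U. lt y x"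
  using assms unfolding dense_order_def by - (elim conjE, (assumption | blast))+

text \<open>It suffices to separate the greatest element of \<open>L\<close> from the least element
  of \<open>G\<close> by density. If one of the sets is empty, the absence of endpoints takes the
  place of density.\<close>

lemma dense_order_between:
  assumes D: "dense_order V lt" and "finite L" "finite G" "L \<subseteq> V" "G \<subseteq> V"
    and LG: "\<And>x y. x \<in> L \<Longrightarrow> y \<in> G \<Longrightarrow> lt x y"
  shows "\<exists>b\<in>V. (\<forall>x\<in>L. lt x b) \<and> (\<forall>y\<in>G. lt b y)"
proof -
  note trans = dense_order_trans[OF D]
  have asymp: "asymp_on A lt" if "A \<subseteq> V" for A
  proof (rule asymp_onI)
    fix x y assume "x \<in> A" "y \<in> A" "lt x y"
    then show "\<not> lt y x"
      using trans[of x y x] dense_order_irrefl[OF D, of x] that by blast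
  qed
  have transp: "transp_on A lt" if "A \<subseteq> V" for A
  proof (rule transp_onI)
    fix x y z assume "x \<in> A" "y \<in> A" "z \<in> A" "lt x y" "lt y z"
    then show "lt x z" using trans[of x y z] that by blast
  qed
  have max: "\<exists>m\<in>L. \<forall>x\<in>L. x \<noteq> m \<longrightarrow> lt x m" if "L \<noteq> {}"
    using Finite_Set.bex_max_element[OF \<open>finite L\<close> asymp transp that, OF \<open>L \<subseteq> V\<close> \<open>L \<subseteq> V\<close>]
      dense_order_total[OF D] \<open>L \<subseteq> V\<close> by (meson subsetD)
  have min: "\<exists>m\<in>G. \<forall>x\<in>G. x \<noteq> m \<longrightarrow> lt m x" if "G \<noteq> {}"
    using Finite_Set.bex_min_element[OF \<open>finite G\<close> asymp transp that, OF \<open>G \<subseteq> V\<close> \<open>G \<subseteq> V\<close>]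
      dense_order_total[OF D] \<open>G \<subseteq> V\<close> by (meson subsetD)
  have above: "\<forall>x\<in>L. lt x b" if "b \<in> V" "m \<in> L" "lt m b" "\<forall>x\<in>L. x \<noteq> m \<longrightarrow> lt x m" for b m
    using that trans \<open>L \<subseteq> V\<close> by (metis subsetD)
  have below: "\<forall>x\<in>G. lt b x" if "b \<in> V" "m \<in> G" "lt b m" "\<forall>x\<in>G. x \<noteq> m \<longrightarrow> lt m x" for b m
    using that trans \<open>G \<subseteq> V\<close> by (metis subsetD)
  show ?thesis
  proof (cases "L = {}")
    case True
    show ?thesis
    proof (cases "G = {}")
      case True
      then show ?thesis using dense_order_nonempty[OF D] \<open>L = {}\<close> by auto
    next
      case False
      then obtain m where m: "m \<in> G" "\<forall>x\<in>G. x \<noteq> m \<longrightarrow> lt m x" using min by blast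
      moreover obtain b where "b \<in> V" "lt b m"
        using dense_order_no_min[OF D] m(1) \<open>G \<subseteq> V\<close> by blast
      ultimately show ?thesis using below \<open>L = {}\<close> by blast
    qed
  next
    case False
    then obtain m where m: "m \<in> L" "\<forall>x\<in>L. x \<noteq> m \<longrightarrow> lt x m" using max by blast
    show ?thesis
    proof (cases "G = {}")
      case True
      moreover obtain b where "b \<in> V" "lt m b"
        using dense_order_no_max[OF D] m(1) \<open>L \<subseteq> V\<close> by blast
      ultimately show ?thesis using above m by blast
    next
      case False
      then obtain m' where m': "m' \<in> G" "\<forall>x\<in>G. x \<noteq> m' \<longrightarrow> lt m' x" using min by blast
      moreover obtain b where "b \<in> V" "lt m b" "lt b m'"
        using dense_order_dense[OF D] m(1) m'(1) LG \<open>L \<subseteq> V\<close> \<open>G \<subseteq> V\<close> by blast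
      ultimately show ?thesis using above below m by blast
    qed
  qed
qed

section \<open>Cantor's back-and-forth argument\<close>

definition finite_order_isos ::
    "'a set \<Rightarrow> ('a \<Rightarrow> 'a \<Rightarrow> bool) \<Rightarrow> 'b set \<Rightarrow> ('b \<Rightarrow> 'b \<Rightarrow> bool) \<Rightarrow> ('a \<times> 'b) set set"
  where "finite_order_isos U lt V lt' = {R. finite R \<and> R \<subseteq> U \<times> V \<and>
    (\<forall>x y x' y'. (x, y) \<in> R \<longrightarrow> (x', y') \<in> R \<longrightarrow> (lt x x' \<longleftrightarrow> lt' y y'))}"

text \<open>This reduces the back condition to the forth condition with the two orders
  exchanged.\<close>

lemma finite_order_isos_converse:
  "R \<in> finite_order_isos U lt V lt' \<Longrightarrow> R\<inverse> \<in> finite_order_isos V lt' U lt"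
  by (auto simp: finite_order_isos_def)

text \<open>In a strict linear order, elements are equal exactly when neither is below the other, so
  equality is preserved along with the order.\<close>

lemma finite_order_isos_eq_iff:
  assumes "dense_order U lt" "dense_order V lt'" "R \<in> finite_order_isos U lt V lt'"
    and "(x, y) \<in> R" "(x', y') \<in> R"
  shows "x = x' \<longleftrightarrow> y = y'"
proof -
  have "x \<in> U" "x' \<in> U" "y \<in> V" "y' \<in> V" "lt x x' \<longleftrightarrow> lt' y y'" "lt x' x \<longleftrightarrow> lt' y' y"
    using assms(3-) by (auto simp: finite_order_isos_def)
  then show ?thesis
    using assms(1,2) by (metis dense_order_irrefl dense_order_total)
qed

text \<open>A new element \<open>a\<close> is sent to a point that separates the images of the
  elements below \<open>a\<close> from the images of those above it.\<close>

lemma finite_order_isos_forth: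
  assumes U: "dense_order U lt" and V: "dense_order V lt'"
    and R: "R \<in> finite_order_isos U lt V lt'" and a: "a \<in> U"
  shows "\<exists>b. insert (a, b) R \<in> finite_order_isos U lt V lt'"
proof (cases "a \<in> Domain R")
  case True
  then obtain b where "(a, b) \<in> R" by blast
  then have "insert (a, b) R = R" by blast
  then show ?thesis using R by metis
next
  case False
  have fin: "finite R" and RUV: "\<And>x y. (x, y) \<in> R \<Longrightarrow> x \<in> U \<and> y \<in> V"
    and iso: "\<And>x y x' y'. (x, y) \<in> R \<Longrightarrow> (x', y') \<in> R \<Longrightarrow> lt x x' \<longleftrightarrow> lt' y y'"
    using R by (auto simp: finite_order_isos_def)
  let ?L = "{y. \<exists>x. (x, y) \<in> R \<and> lt x a}" and ?G = "{y. \<exists>x. (x, y) \<in> R \<and> lt a x}"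
  have "finite ?L" "finite ?G"
    using fin by (auto intro: finite_subset[OF _ finite_Range])
  moreover have "lt' y y'" if "y \<in> ?L" "y' \<in> ?G" for y y'
    using that RUV iso a dense_order_trans[OF U] by blast
  ultimately obtain b where b: "b \<in> V" "\<forall>y\<in>?L. lt' y b" "\<forall>y\<in>?G. lt' b y"
    using dense_order_between[OF V, of ?L ?G] RUV by blast
  \<comment> \<open>The choice of \<open>b\<close> gives the implications from left to right. The
    converses follow from trichotomy in \<open>U\<close>, as \<open>x\<close> differs from
    \<open>a\<close>, and asymmetry in \<open>V\<close>.\<close>
  have "(lt x a \<longleftrightarrow> lt' y b) \<and> (lt a x \<longleftrightarrow> lt' b y)" if xy: "(x, y) \<in> R" for x y
  proof -
    have "x \<noteq> a" using False xy by blast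
    moreover have "\<not> (lt x a \<and> lt a x)" "\<not> (lt' y b \<and> lt' b y)"
      using RUV[OF xy] a b(1) dense_order_trans dense_order_irrefl U V by metis+
    moreover have "lt x a \<longrightarrow> lt' y b" "lt a x \<longrightarrow> lt' b y" using b xy by blast+
    ultimately show ?thesis using dense_order_total[OF U] RUV[OF xy] a by blast
  qed
  then have "insert (a, b) R \<in> finite_order_isos U lt V lt'"
    using fin RUV iso a b(1) dense_order_irrefl[OF U a] dense_order_irrefl[OF V b(1)]
    unfolding finite_order_isos_def by auto
  then show ?thesis ..
qed

definition order_struct :: "'a set \<Rightarrow> ('a \<Rightarrow> 'a \<Rightarrow> bool) \<Rightarrow> 'a struct"
  where "order_struct U lt =
    \<lparr>universe = U, pred = (\<lambda>_ xs. lt (xs ! 0) (xs ! 1)), func = (\<lambda>_ _. undefined)\<rparr>"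

lemma order_struct_simps [simp]:
  "universe (order_struct U lt) = U"
  "pred (order_struct U lt) P xs = lt (xs ! 0) (xs ! 1)"
  by (simp_all add: order_struct_def)

abbreviation less_sym :: symbol
  where "less_sym \<equiv> PredSym 0 2"

lemma dense_order_back_and_forth:
  assumes U: "dense_order U lt" and V: "dense_order V lt'"
  shows "back_and_forth {less_sym} (order_struct U lt) (order_struct V lt')
    (finite_order_isos U lt V lt')"
proof -
  have "{} \<in> finite_order_isos U lt V lt'" by (simp add: finite_order_isos_def)
  moreover have "\<exists>a. insert (a, b) R \<in> finite_order_isos U lt V lt'"
    if "R \<in> finite_order_isos U lt V lt'" "b \<in> V" for R b
  proof -
    have "\<exists>a. insert (b, a) (R\<inverse>) \<in> finite_order_isos V lt' U lt"
      using finite_order_isos_forth[OF V U finite_order_isos_converse] that by blast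
    then obtain a where "insert (b, a) (R\<inverse>) \<in> finite_order_isos V lt' U lt" ..
    moreover have "(insert (b, a) (R\<inverse>))\<inverse> = insert (a, b) R" by auto
    ultimately show ?thesis by (metis finite_order_isos_converse)
  qed
  moreover have "partial_isomorphism {less_sym} (order_struct U lt) (order_struct V lt') R"
    if R: "R \<in> finite_order_isos U lt V lt'" for R
    unfolding partial_isomorphism_def
  proof (intro conjI allI impI)
    show "R \<subseteq> universe (order_struct U lt) \<times> universe (order_struct V lt')"
      using R by (simp add: finite_order_isos_def)
    show "x = x' \<longleftrightarrow> y = y'" if "(x, y) \<in> R" "(x', y') \<in> R" for x y x' y'
      using finite_order_isos_eq_iff[OF U V R that] .
    show "pred (order_struct U lt) P xs \<longleftrightarrow> pred (order_struct V lt') P ys"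
      if "PredSym P (length xs) \<in> {less_sym}" "list_all2 (\<lambda>x y. (x, y) \<in> R) xs ys" for P xs ys
      using that R by (auto simp: finite_order_isos_def list_all2_conv_all_nth)
  qed
  ultimately show ?thesis
    using finite_order_isos_forth[OF U V] by (auto simp: back_and_forth_def)
qed

section \<open>Transport of dense orders along injections\<close>

lemma dense_order_pullback:
  assumes V: "dense_order (d ` U) lt" and d: "inj_on d U"
  shows "dense_order U (\<lambda>x y. lt (d x) (d y))"
proof -
  have "lt (d x) (d y) \<or> x = y \<or> lt (d y) (d x)" if "x \<in> U" "y \<in> U" for x y
    using dense_order_total[OF V, of "d x" "d y"] inj_onD[OF d] that by blast
  moreover have "\<exists>z\<in>U. lt (d x) (d z) \<and> lt (d z) (d y)"
    if "x \<in> U" "y \<in> U" "lt (d x) (d y)" for x y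
    using dense_order_dense[OF V, of "d x" "d y"] that by blast
  moreover have "\<exists>y\<in>U. lt (d x) (d y)" "\<exists>y\<in>U. lt (d y) (d x)" if "x \<in> U" for x
    using dense_order_no_max[OF V, of "d x"] dense_order_no_min[OF V, of "d x"] that by blast+
  moreover have "lt (d x) (d z)"
    if "x \<in> U" "y \<in> U" "z \<in> U" "lt (d x) (d y)" "lt (d y) (d z)" for x y z
    using dense_order_trans[OF V that(4,5)] that(1-3) by blast
  moreover have "\<not> lt (d x) (d x)" if "x \<in> U" for x
    using dense_order_irrefl[OF V] that by blast
  moreover have "U \<noteq> {}" using dense_order_nonempty[OF V] by blast
  ultimately show ?thesis
    unfolding dense_order_def by (intro conjI ballI impI)
qed

text \<open>Used to move orders onto subsets of \<open>nat set\<close>, the type of the universes in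
  the theorem. The order on the image is the pullback along the inverse of \<open>e\<close>.\<close>

lemma dense_order_image:
  assumes U: "dense_order U lt" and e: "inj_on e U"
  shows "dense_order (e ` U) (\<lambda>x y. lt (inv_into U e x) (inv_into U e y))"
proof (rule dense_order_pullback)
  have "inv_into U e ` e ` U = U"
    using e by (simp add: image_comp comp_def inv_into_f_f)
  with U show "dense_order (inv_into U e ` e ` U) lt" by simp
  show "inj_on (inv_into U e) (e ` U)" by (rule inj_on_inv_into) simp
qed

section \<open>Cofinalities of the two orders\<close>

lemma card_order_aleph_one: "Card_order aleph_one" "natLeq <o aleph_one" "\<not> finite (Field aleph_one)"
  using cardSuc_Card_order[OF natLeq_Card_order] cardSuc_greater[OF natLeq_Card_order]
    cardSuc_finite[OF natLeq_Card_order] by (simp_all add: Field_natLeq)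

lemma countable_ordLeq_aleph_one:
  fixes A :: "'a::countable set"
  shows "|A| \<le>o aleph_one"
proof -
  have "|A| \<le>o |UNIV :: nat set|"
    by (rule card_of_ordLeqI[of to_nat]) auto
  also have "|UNIV :: nat set| =o natLeq" by (rule card_of_nat)
  also have "natLeq \<le>o aleph_one" using card_order_aleph_one(2) by (rule ordLess_imp_ordLeq)
  finally show ?thesis .
qed

text \<open>A countable set is smaller than the regular cardinal \<open>aleph_one\<close> and
  therefore not cofinal in it.\<close>

lemma sequence_bounded_aleph_one:
  assumes "range f \<subseteq> Field aleph_one"
  shows "\<exists>b\<in>Field aleph_one. \<forall>n::nat. f n \<noteq> b \<and> (f n, b) \<in> aleph_one"
proof -
  have lin: "Linear_order aleph_one"
    using card_order_aleph_one(1) card_order_on_def well_order_on_def by blast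
  have "|range f| \<le>o |UNIV :: nat set|" by (rule card_of_image)
  also have "|UNIV :: nat set| =o natLeq" by (rule card_of_nat)
  also have "natLeq <o aleph_one" by (rule card_order_aleph_one(2))
  finally have "|range f| <o aleph_one" .
  then have "\<not> |range f| =o aleph_one" by (rule not_ordLess_ordIso)
  moreover have "regularCard aleph_one"
    using natLeq_Card_order by (intro infinite_cardSuc_regularCard) (auto simp: Field_natLeq)
  ultimately have "\<not> cofinal (range f) aleph_one"
    using assms unfolding regularCard_def by blast
  \<comment> \<open>Failure of cofinality gives only a weak upper bound \<open>a\<close>, possibly
    one of the values; passing to a larger \<open>b\<close> makes the bound strict.\<close>
  then obtain a where a: "a \<in> Field aleph_one" "\<And>n. a = f n \<or> (a, f n) \<notin> aleph_one"
    unfolding cofinal_def by auto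
  obtain b where b: "b \<in> Field aleph_one" "a \<noteq> b" "(a, b) \<in> aleph_one"
    using infinite_Card_order_limit[OF card_order_aleph_one(1,3) a(1)] by blast
  have "f n \<noteq> b \<and> (f n, b) \<in> aleph_one" for n
  proof -
    have "f n \<in> Field aleph_one" using assms by auto
    then have "(f n, a) \<in> aleph_one"
      using a lin unfolding order_on_defs refl_on_def total_on_def by metis
    then show ?thesis
      using b lin unfolding order_on_defs by (metis antisymD transD)
  qed
  with b(1) show ?thesis by blast
qed

text \<open>The well-order \<open>aleph_one\<close> itself is not dense. A rational second
  coordinate supplies density and removes the endpoints, while the dominant first coordinate keeps
  sequences bounded.\<close>

lemma dense_order_cofinality_aleph_one:
  obtains U :: "nat set set" and lt where "dense_order U lt" "|U| \<le>o aleph_one"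
    "\<And>f::nat \<Rightarrow> nat set. range f \<subseteq> U \<Longrightarrow> \<exists>b\<in>U. \<forall>n. lt (f n) b"
proof -
  let ?F = "Field aleph_one"
  define A where "A = ?F \<times> (UNIV :: rat set)"
  define below where "below a b \<longleftrightarrow> a \<noteq> b \<and> (a, b) \<in> aleph_one" for a b
  define lex where "lex x y \<longleftrightarrow> below (fst x) (fst y) \<or> fst x = fst y \<and> snd x < snd y"
    for x y :: "nat set \<times> rat"
  have lin: "Linear_order aleph_one"
    using card_order_aleph_one(1) card_order_on_def well_order_on_def by blast
  have trans: "below a c" if "below a b" "below b c" for a b c
    using that lin unfolding below_def order_on_defs by (metis antisymD transD)
  have total: "below a b \<or> a = b \<or> below b a" if "a \<in> ?F" "b \<in> ?F" for a b
    using that lin unfolding below_def order_on_defs total_on_def by metis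
  have "?F \<noteq> {}" using card_order_aleph_one(3) by auto
  have lex: "dense_order A lex"
    unfolding dense_order_def
  proof (intro conjI ballI impI)
    show "A \<noteq> {}" using \<open>?F \<noteq> {}\<close> by (simp add: A_def)
  next
    fix x assume "x \<in> A"
    show "\<not> lex x x" by (simp add: lex_def below_def)
    show "\<exists>y\<in>A. lex x y"
      using \<open>x \<in> A\<close> by (intro bexI[of _ "(fst x, snd x + 1)"]) (auto simp: lex_def A_def)
    show "\<exists>y\<in>A. lex y x"
      using \<open>x \<in> A\<close> by (intro bexI[of _ "(fst x, snd x - 1)"]) (auto simp: lex_def A_def)
  next
    fix x y assume xy: "x \<in> A" "y \<in> A"
    show "lex x y \<or> x = y \<or> lex y x"
      using total[of "fst x" "fst y"] xy by (auto simp: lex_def A_def)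
    assume "lex x y"
    show "\<exists>z\<in>A. lex x z \<and> lex z y"
    proof (cases "fst x = fst y")
      case True
      then have "snd x < snd y" using \<open>lex x y\<close> by (auto simp: lex_def below_def)
      then obtain q where "snd x < q" "q < snd y" using dense by blast
      then show ?thesis
        using True xy by (intro bexI[of _ "(fst x, q)"]) (auto simp: lex_def A_def)
    next
      case False
      \<comment> \<open>Here \<open>fst x\<close> is strictly below \<open>fst y\<close>, so raising
        only the rational coordinate of \<open>x\<close> stays below \<open>y\<close>.\<close>
      then show ?thesis
        using \<open>lex x y\<close> xy by (intro bexI[of _ "(fst x, snd x + 1)"]) (auto simp: lex_def A_def)
    qed
  next
    fix x y z assume "lex x y" "lex y z"
    then show "lex x z" unfolding lex_def using trans by auto
  qed
  have cofinal: "\<exists>b\<in>A. \<forall>n. lex (f n) b" if f: "range f \<subseteq> A" for f :: "nat \<Rightarrow> _"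
  proof -
    have "range (fst \<circ> f) \<subseteq> ?F" using f by (auto simp: A_def)
    from sequence_bounded_aleph_one[OF this] obtain b where "b \<in> ?F" "\<forall>n. below (fst (f n)) b"
      by (auto simp: below_def)
    \<comment> \<open>The first coordinate decides all comparisons, so any rational would serve in
      place of \<open>0\<close>.\<close>
    then show ?thesis by (intro bexI[of _ "(b, 0)"]) (auto simp: lex_def A_def)
  qed
  have "|?F| =o aleph_one" by (rule card_of_Field_ordIso[OF card_order_aleph_one(1)])
  then have A: "|A| \<le>o aleph_one"
    unfolding A_def using card_order_aleph_one countable_ordLeq_aleph_one
    by (intro card_of_Times_ordLeq_infinite_Field) (auto intro: ordIso_imp_ordLeq)
  also have "aleph_one =o |?F|" by (rule ordIso_symmetric) fact
  \<comment> \<open>The elements of \<open>?F\<close> have type \<open>nat set\<close>, so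
    \<open>e\<close> copies \<open>A\<close> into this type.\<close>
  finally obtain e where e: "inj_on e A" "e ` A \<subseteq> ?F" by (auto simp: card_of_ordLeq[symmetric])
  show thesis
  proof
    show "dense_order (e ` A) (\<lambda>x y. lex (inv_into A e x) (inv_into A e y))"
      by (rule dense_order_image[OF lex e(1)])
    show "|e ` A| \<le>o aleph_one" using card_of_image A by (rule ordLeq_transitive)
    fix f :: "nat \<Rightarrow> nat set" assume f: "range f \<subseteq> e ` A"
    then have "range (inv_into A e \<circ> f) \<subseteq> A" by (simp add: image_subset_iff inv_into_into)
    from cofinal[OF this] obtain b where "b \<in> A" "\<forall>n. lex (inv_into A e (f n)) b" by auto
    then show "\<exists>b\<in>e ` A. \<forall>n. lex (inv_into A e (f n)) (inv_into A e b)"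
      by (auto simp: inv_into_f_f[OF e(1)])
  qed
qed

text \<open>The naturals inside \<rat> provide \<open>c\<close>, by the Archimedean property. Having
  a whole tail of \<open>c\<close> above \<open>x\<close> allows an index to be replaced by any
  larger one, which is what domination of index functions requires.\<close>

lemma dense_order_cofinality_omega:
  obtains V :: "nat set set" and lt c where "dense_order V lt" "|V| \<le>o aleph_one"
    "range c \<subseteq> V" "\<And>x. x \<in> V \<Longrightarrow> \<exists>k::nat. \<forall>n\<ge>k. lt x (c n)"
proof -
  \<comment> \<open>Singletons of codes embed \<rat> into the type \<open>nat set\<close>.\<close>
  define e :: "rat \<Rightarrow> nat set" where "e q = {to_nat q}" for q
  have e: "inj e" by (auto simp: inj_def e_def)
  have rat: "dense_order UNIV ((<) :: rat \<Rightarrow> _)"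
    unfolding dense_order_def by (auto intro: gt_ex lt_ex dense)
  show thesis
  proof
    show "dense_order (range e) (\<lambda>x y. inv e x < inv e y)"
      by (rule dense_order_image[OF rat e])
    show "|range e| \<le>o aleph_one"
      using card_of_image countable_ordLeq_aleph_one by (rule ordLeq_transitive)
    show "range (\<lambda>n. e (of_nat n)) \<subseteq> range e" by auto
    fix x assume "x \<in> range e"
    obtain k where k: "inv e x < of_nat k" using reals_Archimedean2 by blast
    have "inv e x < of_nat n" if "n \<ge> k" for n
    proof -
      have "(of_nat k :: rat) \<le> of_nat n" using that by simp
      with k show ?thesis by simp
    qed
    then show "\<exists>k. \<forall>n\<ge>k. inv e x < inv e (e (of_nat n))"
      by (auto simp: inv_f_f[OF e])
  qed
qed

section \<open>Ultraproducts\<close>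

text \<open>If the complement of some point \<open>k\<close> were not in \<open>D\<close>, then
  \<open>{k}\<close> would be, making \<open>D\<close> principal. Hence \<open>D\<close> contains
  all tails, and relations \<open>\<le>*\<close> hold \<open>D\<close>-almost everywhere.\<close>

lemma nonprincipal_ultrafilter_le_sequentially:
  assumes D: "ultrafilter D" "nonprincipal D"
  shows "D \<le> sequentially"
proof -
  have ne: "\<forall>\<^sub>F n in D. n \<noteq> k" for k :: nat
  proof (rule ccontr)
    assume "\<not> (\<forall>\<^sub>F n in D. n \<noteq> k)"
    then have k: "\<forall>\<^sub>F n in D. n = k" using D(1) unfolding ultrafilter_def by blast
    have "D = principal {k}"
    proof (rule filter_eq_iff[THEN iffD2], intro allI iffI)
      fix P assume "eventually P D"
      then have "\<forall>\<^sub>F n in D. P k" using k by eventually_elim simp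
      \<comment> \<open>The statement \<open>P k\<close> does not depend on \<open>n\<close> and
        holds along a proper filter, so it is true.\<close>
      then have "P k" using D(1) unfolding ultrafilter_def by (cases "P k") (auto simp: trivial_limit_def)
      then show "eventually P (principal {k})" by (simp add: eventually_principal)
    next
      fix P assume "eventually P (principal {k})"
      then show "eventually P D" using k by (auto simp: eventually_principal elim: eventually_mono)
    qed
    then show False using D(2) unfolding nonprincipal_def by blast
  qed
  have "\<forall>\<^sub>F n in D. n \<ge> N" for N :: nat
  proof (induction N)
    case (Suc N)
    then show ?case using ne[of N] by eventually_elim simp
  qed simp
  then show ?thesis
    unfolding le_filter_def eventually_sequentially by (blast intro: eventually_mono)
qed

lemma less_bounding_number_bounded:
  assumes "|F| <o bounding_number"
  shows "\<exists>g. \<forall>f\<in>F. f \<le>* g"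
proof (rule ccontr)
  assume "\<not> ?thesis"
  then have "unbounded_family F" by (simp add: unbounded_family_def)
  then have "bounding_number \<le>o |F|" using bounding_number_least by metis
  then show False using assms not_ordLess_ordLeq by blast
qed

text \<open>An isomorphism \<open>h\<close> maps the classes of constants to at most |U| many
  classes, which have a common strict upper bound. The preimage of this bound lies below the class
  of some constant, so the bound lies below the image of that constant, a contradiction.\<close>

lemma ultraproduct_order_struct_not_isomorphic:
  assumes V: "dense_order V lt'"
    and U: "|U| <o bounding_number" "\<And>f::nat \<Rightarrow> 'a. range f \<subseteq> U \<Longrightarrow> \<exists>b\<in>U. \<forall>n. lt (f n) b"
    and c: "range c \<subseteq> V" "\<And>x. x \<in> V \<Longrightarrow> \<exists>k::nat. \<forall>n\<ge>k. lt' x (c n)"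
    and D: "D \<noteq> bot" "D \<le> sequentially"
  shows "\<not> isomorphic {less_sym} (ultraproduct D (\<lambda>_. order_struct U lt))
    (ultraproduct D (\<lambda>_. order_struct V lt'))"
proof
  let ?M = "\<lambda>_::nat. order_struct U lt" and ?N = "\<lambda>_::nat. order_struct V lt'"
  let ?U = "ultraproduct D ?M" and ?V = "ultraproduct D ?N"
  let ?cl = "\<lambda>f. ultra_rel D ?M `` {f}" and ?cl' = "\<lambda>g. ultra_rel D ?N `` {g}"
  assume "isomorphic {less_sym} ?U ?V"
  then obtain h where bij: "bij_betw h (universe ?U) (universe ?V)"
    and h: "\<And>X Y. X \<in> universe ?U \<Longrightarrow> Y \<in> universe ?U \<Longrightarrow>
      pred ?U 0 [X, Y] \<longleftrightarrow> pred ?V 0 [h X, h Y]"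
    unfolding isomorphic_def isomorphism_def tuples_def by auto
  have univ_U: "universe ?U = {?cl f | f. range f \<subseteq> U}"
    by (auto simp: ultraproduct_def quotient_def Pi_def image_subset_iff)
  have univ_V: "universe ?V = {?cl' g | g. range g \<subseteq> V}"
    by (auto simp: ultraproduct_def quotient_def Pi_def image_subset_iff)
  have pred_U: "pred ?U 0 [?cl f, ?cl f'] \<longleftrightarrow> (\<forall>\<^sub>F n in D. lt (f n) (f' n))"
    if "range f \<subseteq> U" "range f' \<subseteq> U" for f f'
    using pred_ultraproduct[of "[f, f']" ?M D 0] that by (simp add: Pi_def image_subset_iff)
  have pred_V: "pred ?V 0 [?cl' g, ?cl' g'] \<longleftrightarrow> (\<forall>\<^sub>F n in D. lt' (g n) (g' n))"
    if "range g \<subseteq> V" "range g' \<subseteq> V" for g g'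
    using pred_ultraproduct[of "[g, g']" ?N D 0] that by (simp add: Pi_def image_subset_iff)
  have const_U: "?cl (\<lambda>_. a) \<in> universe ?U" if "a \<in> U" for a
    using that unfolding univ_U by blast
  \<comment> \<open>For each constant \<open>a\<close>, a representative \<open>g a\<close> of its
    image under \<open>h\<close> is fixed.\<close>
  have "\<exists>g. range g \<subseteq> V \<and> h (?cl (\<lambda>_. a)) = ?cl' g" if "a \<in> U" for a
    using bij_betwE[OF bij] const_U[OF that] unfolding univ_V by blast
  then obtain g where g: "\<And>a. a \<in> U \<Longrightarrow> range (g a) \<subseteq> V"
      "\<And>a. a \<in> U \<Longrightarrow> h (?cl (\<lambda>_. a)) = ?cl' (g a)"
    by metis
  have "\<exists>k. \<forall>m\<ge>k. lt' (g a n) (c m)" if "a \<in> U" for a n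
    using c(2)[of "g a n"] g(1)[OF that] by blast
  \<comment> \<open>\<open>\<psi> a\<close> codes \<open>g a\<close> by a function on the naturals:
    \<open>\<psi> a n\<close> is an index from which on \<open>c\<close> stays above
    \<open>g a n\<close>.\<close>
  then obtain \<psi> where \<psi>: "\<And>a n m. a \<in> U \<Longrightarrow> \<psi> a n \<le> m \<Longrightarrow> lt' (g a n) (c m)"
    by metis
  have "|\<psi> ` U| <o bounding_number"
    using card_of_image U(1) by (rule ordLeq_ordLess_trans)
  \<comment> \<open>As there are fewer than \<open>bounding_number\<close> many codes, one
    \<open>H\<close> dominates them all; the sequence \<open>c (H n)\<close> represents the common
    upper bound.\<close>
  then obtain H where H: "\<And>a. a \<in> U \<Longrightarrow> \<psi> a \<le>* H"
    using less_bounding_number_bounded by fastforce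
  have cH: "range (\<lambda>n. c (H n)) \<subseteq> V" using c(1) by auto
  then have "?cl' (\<lambda>n. c (H n)) \<in> universe ?V" unfolding univ_V by blast
  then have "?cl' (\<lambda>n. c (H n)) \<in> h ` universe ?U"
    by (simp only: bij_betw_imp_surj_on[OF bij])
  then obtain X where X: "?cl' (\<lambda>n. c (H n)) = h X" "X \<in> universe ?U" by (rule imageE)
  then obtain f where f: "range f \<subseteq> U" "X = ?cl f" unfolding univ_U by blast
  \<comment> \<open>The values of \<open>f\<close> form a countable subset of \<open>U\<close>, so a
    single \<open>a\<close> exceeds all of them.\<close>
  obtain a where a: "a \<in> U" "\<And>n. lt (f n) a" using U(2)[OF f(1)] by blast
  have "pred ?U 0 [X, ?cl (\<lambda>_. a)]"
    unfolding f(2) using pred_U[OF f(1), of "\<lambda>_. a"] a by auto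
  then have "pred ?V 0 [?cl' (\<lambda>n. c (H n)), ?cl' (g a)]"
    unfolding X(1) g(2)[OF a(1), symmetric] using h[OF X(2) const_U[OF a(1)]] by simp
  then have "\<forall>\<^sub>F n in D. lt' (c (H n)) (g a n)"
    using pred_V[OF cH g(1)[OF a(1)]] by simp
  moreover have "\<forall>\<^sub>F n in D. \<psi> a n \<le> H n"
    using H[OF a(1)] D(2) unfolding eventually_le_def by (rule filter_leD[rotated])
  \<comment> \<open>For \<open>D\<close>-almost all \<open>n\<close>, the elements
    \<open>c (H n)\<close> and \<open>g a n\<close> lie strictly below each other.\<close>
  ultimately have "\<forall>\<^sub>F n in D. False"
  proof eventually_elim
    case (elim n)
    have "lt' (g a n) (c (H n))" using \<psi>[OF a(1) elim(2)] .
    moreover have "g a n \<in> V" "c (H n) \<in> V" using g(1)[OF a(1)] cH by auto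
    ultimately show False
      using elim(1) dense_order_trans[OF V] dense_order_irrefl[OF V] by blast
  qed
  then show False using D(1) by (simp add: trivial_limit_def)
qed

text \<open>When every \<open>k\<close> is winning, the bound \<open>k \<le> n\<close> alone
  determines \<open>game_value m n\<close>, which is therefore \<open>n\<close>.\<close>

lemma protagonist_wins_ultraproduct_problem:
  assumes m: "pseudo_ultraproduct_problem m" and win: "\<And>n k. protagonist_wins m n k"
  shows "ultraproduct_problem m"
proof -
  have "{k. k \<le> n \<and> protagonist_wins m n k} = {..n}" for n
    using win by auto
  then have game_value: "game_value m n = n" for n
    unfolding game_value_def by (simp add: Max_eq_iff)
  have "enat N \<le> limsup (\<lambda>n. enat n)" for N
    by (rule le_Limsup) (auto simp: eventually_sequentially)
  then have "limsup (\<lambda>n. enat n) = \<infinity>"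
    by (cases "limsup (\<lambda>n. enat n)") (simp_all, metis Suc_n_not_le_n)
  then show ?thesis using m by (simp add: ultraproduct_problem_def game_value)
qed

section \<open>Construction of the ultraproduct problem\<close>

theorem theorem3p1:
  assumes "aleph_one <o bounding_number"
  shows "\<exists>m :: nat set upp. ultraproduct_problem m \<and>
    (\<forall>n. elementarily_equivalent (full_vocab m) (left m n) (right m n)) \<and>
    (\<forall>D. ultrafilter D \<and> nonprincipal D \<longrightarrow>
      \<not> isomorphic (full_vocab m) (ultraproduct D (left m)) (ultraproduct D (right m)))"
proof -
  obtain U :: "nat set set" and lt where U: "dense_order U lt" "|U| \<le>o aleph_one"
    "\<And>f::nat \<Rightarrow> nat set. range f \<subseteq> U \<Longrightarrow> \<exists>b\<in>U. \<forall>n. lt (f n) b"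
    using dense_order_cofinality_aleph_one by metis
  obtain V :: "nat set set" and lt' c where V: "dense_order V lt'" "|V| \<le>o aleph_one"
    and c: "range c \<subseteq> V" "\<And>x. x \<in> V \<Longrightarrow> \<exists>k::nat. \<forall>n\<ge>k. lt' x (c n)"
    using dense_order_cofinality_omega by metis
  \<comment> \<open>The order symbol enters at stage \<open>1\<close>, since the vocabulary at stage
    \<open>0\<close> has to be empty.\<close>
  define m :: "nat set upp" where "m = \<lparr>left = (\<lambda>_. order_struct U lt),
    right = (\<lambda>_. order_struct V lt'), vocab = (\<lambda>n. if n = 0 then {} else {less_sym})\<rparr>"
  have simps: "left m = (\<lambda>_. order_struct U lt)" "right m = (\<lambda>_. order_struct V lt')"
    "vocab m n = (if n = 0 then {} else {less_sym})" for n
    by (simp_all add: m_def)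
  have vocab: "full_vocab m = {less_sym}"
    unfolding full_vocab_def simps by auto
  have rel: "relational (full_vocab m)" by (simp add: relational_def vocab)
  have ne: "U \<noteq> {}" "V \<noteq> {}" using U(1) V(1) by (auto dest: dense_order_nonempty)
  \<comment> \<open>One system serves for every \<open>n\<close>; it yields both the winning
    strategies and the elementary equivalence.\<close>
  have bf: "back_and_forth (full_vocab m) (left m n) (right m n) (finite_order_isos U lt V lt')" for n
    unfolding vocab simps by (rule dense_order_back_and_forth[OF U(1) V(1)])
  have "pseudo_ultraproduct_problem m"
    using U(2) V(2) ne
    by (auto simp: pseudo_ultraproduct_problem_def is_structure_def vocab simps)
  then have "ultraproduct_problem m"
    using back_and_forth_protagonist_wins[OF bf rel] by (rule protagonist_wins_ultraproduct_problem)
  moreover have "elementarily_equivalent (full_vocab m) (left m n) (right m n)" for n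
    using back_and_forth_elementarily_equivalent[OF bf rel] ne by (simp add: simps)
  moreover have "\<not> isomorphic (full_vocab m) (ultraproduct D (left m)) (ultraproduct D (right m))"
    if D: "ultrafilter D" "nonprincipal D" for D
    unfolding vocab simps
  proof (rule ultraproduct_order_struct_not_isomorphic[OF V(1) _ U(3) c])
    \<comment> \<open>Here the hypothesis on the bounding number enters.\<close>
    show "|U| <o bounding_number" using U(2) assms by (rule ordLeq_ordLess_trans)
    show "D \<noteq> bot" using D(1) by (simp add: ultrafilter_def)
    show "D \<le> sequentially" using D by (rule nonprincipal_ultrafilter_le_sequentially)
  qed
  ultimately show ?thesis by blast
qed

end
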